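(* For any tense logic $L$, the cardinality of the set of pretabular extensions of $L$ is either $\leq\aleph_0$ or $2^{\aleph_0}$.
   Context: We work in ZFC (no Continuum Hypothesis). Tense formulas are generated from a countable set $\mathsf{Prop}$ of propositional variables by $\phi::=p\mid\bot\mid\phi\land\psi\mid\phi\to\psi\mid\Box_0\phi\mid\Box_1\phi$. A tense logic is a set of tense formulas containing all propositional tautologies, the axioms $\Box_i(p\to q)\to\Box_i p\to\Box_i q$ for $i=0,1$, and the axioms $p\to\Box_0\lnot\Box_1\lnot p$ and $p\to\Box_1\lnot\Box_0\lnot p$, and closed under modus ponens, necessitation (for both boxes) and uniform substitution. An extension of $L$ is a tense logic $L'$ with $L\subseteq L'$; it is proper if $L'\neq L$. A tense logic is consistent if it is not the set of all formulas. A Kripke frame $\mathcal{F}=(F,R)$ is a nonempty set $F$ with a binary relation $R\subseteq F\times F$. A valuation $V:\mathsf{Prop}\to\mathcal{P}(F)$ extends to all formulas, with Boolean connectives interpreted by Boolean operations, $V(\Box_0\phi)=\{x:\forall y\,(Rxy\to y\in V(\phi))\}$ and $V(\Box_1\phi)=\{x:\forall y\,(Ryx\to y\in V(\phi))\}$. $\mathcal{F}\models\phi$ means $V(\phi)=F$ for all valuations $V$. A tense logic $L$ is tabular if there is a finite Kripke frame $\mathcal{F}$ such that for every formula $\phi$, $\phi\in L$ iff $\mathcal{F}\models\phi$. A tense logic is pretabular if it is not tabular while all its proper consistent extensions are tabular. *)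

theory Defs
  imports Main "HOL-Library.Countable_Set" "HOL-Library.Equipollence"
begin

text \<open>The countably infinite set of propositional variables is \<^typ>\<open>nat\<close>.\<close>

datatype fm =
    Var nat
  | Bot
  | And fm fm
  | Imp fm fm
  | Box0 fm
  | Box1 fm

abbreviation Neg :: "fm \<Rightarrow> fm" where
  "Neg \<phi> \<equiv> Imp \<phi> Bot"

primrec subst :: "(nat \<Rightarrow> fm) \<Rightarrow> fm \<Rightarrow> fm" where
  "subst s (Var p) = s p"
| "subst s Bot = Bot"
| "subst s (And \<phi> \<psi>) = And (subst s \<phi>) (subst s \<psi>)"
| "subst s (Imp \<phi> \<psi>) = Imp (subst s \<phi>) (subst s \<psi>)"
| "subst s (Box0 \<phi>) = Box0 (subst s \<phi>)"
| "subst s (Box1 \<phi>) = Box1 (subst s \<phi>)"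

text \<open>A tautology is a formula that is true under every Boolean assignment to its
  propositional atoms, where boxed formulas count as atoms.\<close>

primrec bool_eval :: "(fm \<Rightarrow> bool) \<Rightarrow> fm \<Rightarrow> bool" where
  "bool_eval v (Var p) = v (Var p)"
| "bool_eval v Bot = False"
| "bool_eval v (And \<phi> \<psi>) = (bool_eval v \<phi> \<and> bool_eval v \<psi>)"
| "bool_eval v (Imp \<phi> \<psi>) = (bool_eval v \<phi> \<longrightarrow> bool_eval v \<psi>)"
| "bool_eval v (Box0 \<phi>) = v (Box0 \<phi>)"
| "bool_eval v (Box1 \<phi>) = v (Box1 \<phi>)"

definition tautology :: "fm \<Rightarrow> bool" where
  "tautology \<phi> \<longleftrightarrow> (\<forall>v. bool_eval v \<phi>)"

definition tense_logic :: "fm set \<Rightarrow> bool" where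
  "tense_logic L \<longleftrightarrow>
     (\<forall>\<phi>. tautology \<phi> \<longrightarrow> \<phi> \<in> L) \<and>
     (\<forall>p q. Imp (Box0 (Imp (Var p) (Var q))) (Imp (Box0 (Var p)) (Box0 (Var q))) \<in> L) \<and>
     (\<forall>p q. Imp (Box1 (Imp (Var p) (Var q))) (Imp (Box1 (Var p)) (Box1 (Var q))) \<in> L) \<and>
     (\<forall>p. Imp (Var p) (Box0 (Neg (Box1 (Neg (Var p))))) \<in> L) \<and>
     (\<forall>p. Imp (Var p) (Box1 (Neg (Box0 (Neg (Var p))))) \<in> L) \<and>
     (\<forall>\<phi> \<psi>. Imp \<phi> \<psi> \<in> L \<longrightarrow> \<phi> \<in> L \<longrightarrow> \<psi> \<in> L) \<and>
     (\<forall>\<phi>. \<phi> \<in> L \<longrightarrow> Box0 \<phi> \<in> L) \<and>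
     (\<forall>\<phi>. \<phi> \<in> L \<longrightarrow> Box1 \<phi> \<in> L) \<and>
     (\<forall>s \<phi>. \<phi> \<in> L \<longrightarrow> subst s \<phi> \<in> L)"

definition extension :: "fm set \<Rightarrow> fm set \<Rightarrow> bool" where
  "extension L L' \<longleftrightarrow> tense_logic L' \<and> L \<subseteq> L'"

definition consistent :: "fm set \<Rightarrow> bool" where
  "consistent L \<longleftrightarrow> L \<noteq> UNIV"

definition kripke_frame :: "'w set \<Rightarrow> 'w rel \<Rightarrow> bool" where
  "kripke_frame F R \<longleftrightarrow> F \<noteq> {} \<and> R \<subseteq> F \<times> F"

primrec truth_set :: "'w set \<Rightarrow> 'w rel \<Rightarrow> (nat \<Rightarrow> 'w set) \<Rightarrow> fm \<Rightarrow> 'w set" where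
  "truth_set F R V (Var p) = V p"
| "truth_set F R V Bot = {}"
| "truth_set F R V (And \<phi> \<psi>) = truth_set F R V \<phi> \<inter> truth_set F R V \<psi>"
| "truth_set F R V (Imp \<phi> \<psi>) = (F - truth_set F R V \<phi>) \<union> truth_set F R V \<psi>"
| "truth_set F R V (Box0 \<phi>) = {x \<in> F. \<forall>y. (x, y) \<in> R \<longrightarrow> y \<in> truth_set F R V \<phi>}"
| "truth_set F R V (Box1 \<phi>) = {x \<in> F. \<forall>y. (y, x) \<in> R \<longrightarrow> y \<in> truth_set F R V \<phi>}"

definition frame_valid :: "'w set \<Rightarrow> 'w rel \<Rightarrow> fm \<Rightarrow> bool" where
  "frame_valid F R \<phi> \<longleftrightarrow> (\<forall>V. (\<forall>p. V p \<subseteq> F) \<longrightarrow> truth_set F R V \<phi> = F)"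

text \<open>Carriers are taken in \<^typ>\<open>nat\<close>: every finite frame is isomorphic to such a frame.
  Lemma \<open>tabularI\<close> below shows that this loses no generality.\<close>

definition tabular :: "fm set \<Rightarrow> bool" where
  "tabular L \<longleftrightarrow>
     (\<exists>(F :: nat set) R. kripke_frame F R \<and> finite F \<and> (\<forall>\<phi>. \<phi> \<in> L \<longleftrightarrow> frame_valid F R \<phi>))"

definition pretabular :: "fm set \<Rightarrow> bool" where
  "pretabular L \<longleftrightarrow>
     tense_logic L \<and> \<not> tabular L \<and>
     (\<forall>L'. extension L L' \<and> L' \<noteq> L \<and> consistent L' \<longrightarrow> tabular L')"

lemma truth_set_subset:
  assumes "\<forall>p. V p \<subseteq> F"
  shows "truth_set F R V \<phi> \<subseteq> F"
  using assms by (induction \<phi>) auto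

lemma truth_set_image:
  assumes inj: "inj_on f F" and R: "R \<subseteq> F \<times> F" and V: "\<forall>p. V p \<subseteq> F"
  shows "truth_set (f ` F) (map_prod f f ` R) (\<lambda>p. f ` V p) \<phi> = f ` truth_set F R V \<phi>"
proof (induction \<phi>)
  case (And \<phi> \<psi>)
  then show ?case
    using inj_on_image_Int[OF inj truth_set_subset[OF V] truth_set_subset[OF V]] by simp
next
  case (Imp \<phi> \<psi>)
  then show ?case
    by (simp add: image_Un inj_on_image_set_diff[OF inj _ truth_set_subset[OF V]])
next
  case (Box0 \<phi>)
  have mem: "f y \<in> f ` truth_set F R V \<phi> \<longleftrightarrow> y \<in> truth_set F R V \<phi>" if "y \<in> F" for y
    using inj_on_image_mem_iff[OF inj that truth_set_subset[OF V]] .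
  have *: "(\<forall>y. (f x, y) \<in> map_prod f f ` R \<longrightarrow> y \<in> f ` truth_set F R V \<phi>) \<longleftrightarrow>
        (\<forall>y. (x, y) \<in> R \<longrightarrow> y \<in> truth_set F R V \<phi>)" (is "?l \<longleftrightarrow> ?r") if x: "x \<in> F" for x
  proof
    assume l: ?l
    show ?r
    proof (intro allI impI)
      fix y assume xy: "(x, y) \<in> R"
      then have "(f x, f y) \<in> map_prod f f ` R" by (rule map_prod_imageI)
      with l mem[of y] xy R show "y \<in> truth_set F R V \<phi>" by blast
    qed
  next
    assume r: ?r
    show ?l
    proof (intro allI impI)
      fix y assume "(f x, y) \<in> map_prod f f ` R"
      then obtain a b where ab: "(a, b) \<in> R" "f x = f a" "y = f b" by auto
      with R x inj have "a = x" by (metis inj_onD mem_Sigma_iff subsetD)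
      with ab r show "y \<in> f ` truth_set F R V \<phi>" by blast
    qed
  qed
  show ?case
    unfolding truth_set.simps Box0.IH Compr_image_eq
    by (rule arg_cong[where f = "image f"], rule Collect_cong, rule conj_cong, rule refl, rule *)
next
  case (Box1 \<phi>)
  have mem: "f y \<in> f ` truth_set F R V \<phi> \<longleftrightarrow> y \<in> truth_set F R V \<phi>" if "y \<in> F" for y
    using inj_on_image_mem_iff[OF inj that truth_set_subset[OF V]] .
  have *: "(\<forall>y. (y, f x) \<in> map_prod f f ` R \<longrightarrow> y \<in> f ` truth_set F R V \<phi>) \<longleftrightarrow>
        (\<forall>y. (y, x) \<in> R \<longrightarrow> y \<in> truth_set F R V \<phi>)" (is "?l \<longleftrightarrow> ?r") if x: "x \<in> F" for x
  proof
    assume l: ?l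
    show ?r
    proof (intro allI impI)
      fix y assume xy: "(y, x) \<in> R"
      then have "(f y, f x) \<in> map_prod f f ` R" by (rule map_prod_imageI)
      with l mem[of y] xy R show "y \<in> truth_set F R V \<phi>" by blast
    qed
  next
    assume r: ?r
    show ?l
    proof (intro allI impI)
      fix y assume "(y, f x) \<in> map_prod f f ` R"
      then obtain a b where ab: "(b, a) \<in> R" "f x = f a" "y = f b" by auto
      with R x inj have "a = x" by (metis inj_onD mem_Sigma_iff subsetD)
      with ab r show "y \<in> f ` truth_set F R V \<phi>" by blast
    qed
  qed
  show ?case
    unfolding truth_set.simps Box1.IH Compr_image_eq
    by (rule arg_cong[where f = "image f"], rule Collect_cong, rule conj_cong, rule refl, rule *)
qed auto

lemma frame_valid_image:
  assumes inj: "inj_on f F" and R: "R \<subseteq> F \<times> F"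
  shows "frame_valid (f ` F) (map_prod f f ` R) \<phi> \<longleftrightarrow> frame_valid F R \<phi>"
proof
  assume *: "frame_valid (f ` F) (map_prod f f ` R) \<phi>"
  show "frame_valid F R \<phi>"
    unfolding frame_valid_def
  proof (intro allI impI)
    fix V :: "nat \<Rightarrow> 'a set" assume V: "\<forall>p. V p \<subseteq> F"
    have "f ` truth_set F R V \<phi> = f ` F"
      using * V truth_set_image[OF inj R V] unfolding frame_valid_def
      by (metis image_mono)
    then show "truth_set F R V \<phi> = F"
      using inj_on_image_eq_iff[OF inj truth_set_subset[OF V] subset_refl] by blast
  qed
next
  assume *: "frame_valid F R \<phi>"
  show "frame_valid (f ` F) (map_prod f f ` R) \<phi>"
    unfolding frame_valid_def
  proof (intro allI impI)
    fix W :: "nat \<Rightarrow> 'b set" assume W: "\<forall>p. W p \<subseteq> f ` F"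
    define V where "V p = {x \<in> F. f x \<in> W p}" for p
    have V: "\<forall>p. V p \<subseteq> F" by (auto simp: V_def)
    have "W = (\<lambda>p. f ` V p)" using W by (fastforce simp: V_def)
    then show "truth_set (f ` F) (map_prod f f ` R) W \<phi> = f ` F"
      using * V truth_set_image[OF inj R V] by (simp add: frame_valid_def)
  qed
qed

lemma tabularI:
  fixes F :: "'w set"
  assumes "kripke_frame F R" "finite F" "\<And>\<phi>. \<phi> \<in> L \<longleftrightarrow> frame_valid F R \<phi>"
  shows "tabular L"
proof -
  obtain f :: "'w \<Rightarrow> nat" where inj: "inj_on f F"
    using finite_imp_inj_to_nat_seg[OF assms(2)] by blast
  have "kripke_frame (f ` F) (map_prod f f ` R)"
    using assms(1) by (auto simp: kripke_frame_def)
  moreover have "\<forall>\<phi>. \<phi> \<in> L \<longleftrightarrow> frame_valid (f ` F) (map_prod f f ` R) \<phi>"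
    using assms frame_valid_image[OF inj] by (auto simp: kripke_frame_def)
  ultimately show ?thesis
    unfolding tabular_def using assms(2) by blast
qed

end

theory Submission imports Defs "HOL-Analysis.Urysohn" "HOL-Analysis.Function_Topology" begin

text \<open>
  A set of tense logics is a subset of the powerset of a countable set, so the theorem is an
  instance of the perfect set property, once the pretabular extensions are put in bijection with
  a \<open>G\<^sub>\<delta>\<close> set in a Polish space.

  Only countably many logics are tabular, since there are only countably many finite frames on
  natural numbers. Hence there are only countably many logics all of whose consistent extensions
  are tabular (\<open>countable_hereditarily_tabular\<close>): such a logic is itself tabular or inconsistent.
  A logic \<open>L\<close> is pretabular iff it is not tabular and, for each \<open>\<phi> \<notin> L\<close>, the logic
  generated by \<open>L\<close> and \<open>\<phi>\<close> is one of them (\<open>pretabular_iff\<close>), because each proper extension of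
  \<open>L\<close> lies above one that is generated in this way.

  Read as a condition on the set \<open>L\<close> in Cantor space, this characterisation is Borel, but not
  obviously \<open>G\<^sub>\<delta>\<close>: it says ``for each \<open>\<phi>\<close> there is an index of a logic such that \<dots>'', and
  ``generates the logic \<open>M\<close>'' is itself only \<open>G\<^sub>\<delta>\<close>. The remedy is to make the index part of the
  point. A pretabular logic is coded by the function on formulas that is \<open>0\<close> on \<open>L\<close> and elsewhere
  sends \<open>\<phi>\<close> to the successor of the index of the logic generated by \<open>L\<close> and \<open>\<phi>\<close>. This code is
  determined by \<open>L\<close>, and \<open>L\<close> is its zero set. Since derivations are finite, ``\<open>\<psi>\<close> is in the logic
  generated by \<open>L\<close> and \<open>\<phi>\<close>'' is an open condition on the code, so the codes form a \<open>G\<^sub>\<delta>\<close> set in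
  the Baire space of functions from formulas to natural numbers (\<open>gdelta_in_pretabular_codes\<close>).

  The perfect set property for \<open>G\<^sub>\<delta>\<close> sets (\<open>gdelta_in_perfect_set_property\<close>) follows by discarding
  the countably many points that are not condensation points; what remains is perfect in a
  completely metrizable space and so has the cardinality of the continuum.
\<close>

section \<open>The perfect set property\<close>

text \<open>The set of condensation points of \<open>S\<close> in \<open>S\<close> omits only countably many points of \<open>S\<close>,
  those with a basic neighbourhood that meets \<open>S\<close> in a countable set. Therefore it has no isolated
  points, and it is closed in \<open>S\<close>, which is completely metrizable.\<close>

lemma gdelta_in_perfect_set_property:
  fixes S :: "'a::second_countable_topology set"
  assumes complete: "completely_metrizable_space (euclidean :: 'a topology)"
    and gdelta: "gdelta_in euclidean S"
  shows "countable S \<or> (UNIV :: real set) \<lesssim> S"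
  unfolding disj_imp
proof
  assume "uncountable S"
  define C where "C = {x \<in> S. \<forall>U. open U \<and> x \<in> U \<longrightarrow> uncountable (S \<inter> U)}"
  obtain B :: "'a set set" where B: "countable B" "topological_basis B"
    using ex_countable_basis by blast
  have "S - C \<subseteq> (\<Union>U \<in> {U \<in> B. countable (S \<inter> U)}. S \<inter> U)"
  proof
    fix x assume "x \<in> S - C"
    then obtain U where "x \<in> S" "open U" "x \<in> U" "countable (S \<inter> U)"
      by (auto simp: C_def)
    moreover obtain W where "W \<in> B" "x \<in> W" "W \<subseteq> U"
      using topological_basisE[OF B(2) \<open>open U\<close> \<open>x \<in> U\<close>] by blast
    moreover have "countable (S \<inter> W)"
      using calculation by (meson Int_mono countable_subset order_refl)
    ultimately show "x \<in> (\<Union>U \<in> {U \<in> B. countable (S \<inter> U)}. S \<inter> U)"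
      by blast
  qed
  moreover have "countable (\<Union>U \<in> {U \<in> B. countable (S \<inter> U)}. S \<inter> U)"
    using B(1) by (intro countable_UN) auto
  ultimately have rest: "countable (S - C)"
    by (rule countable_subset)
  then have "C \<noteq> {}"
    using \<open>uncountable S\<close> by auto
  have "top_of_set S derived_set_of C = C"
  proof
    show "top_of_set S derived_set_of C \<subseteq> C"
    proof
      fix x assume x: "x \<in> top_of_set S derived_set_of C"
      then have "x \<in> S"
        by (simp add: in_derived_set_of)
      moreover have "uncountable (S \<inter> U)" if "open U" "x \<in> U" for U
      proof -
        have "openin (top_of_set S) (S \<inter> U)" "x \<in> S \<inter> U"
          using that \<open>x \<in> S\<close> by (auto simp: openin_open)
        then obtain y where "y \<in> C" "y \<in> U"
          using x unfolding in_derived_set_of by blast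
        then show ?thesis
          using \<open>open U\<close> by (auto simp: C_def)
      qed
      ultimately show "x \<in> C"
        by (auto simp: C_def)
    qed
  next
    show "C \<subseteq> top_of_set S derived_set_of C"
    proof
      fix x assume x: "x \<in> C"
      have "\<exists>y. y \<noteq> x \<and> y \<in> C \<and> y \<in> T" if T: "x \<in> T" "openin (top_of_set S) T" for T
      proof -
        obtain U where U: "open U" "T = S \<inter> U"
          using T(2) by (auto simp: openin_open)
        then have "uncountable (S \<inter> U)"
          using x T(1) by (auto simp: C_def)
        then have "\<not> S \<inter> U \<subseteq> insert x (S - C)"
          using rest countable_subset[of "S \<inter> U" "insert x (S - C)"] by auto
        then show ?thesis
          using U(2) by blast
      qed
      moreover have "x \<in> S"
        using x by (simp add: C_def)
      ultimately show "x \<in> top_of_set S derived_set_of C"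
        unfolding in_derived_set_of by auto
    qed
  qed
  then have "(UNIV :: real set) \<lesssim> C"
    using lepoll_perfect_set \<open>C \<noteq> {}\<close>
      completely_metrizable_space_gdelta_in[OF complete gdelta] by blast
  moreover have "C \<subseteq> S"
    by (auto simp: C_def)
  ultimately show "(UNIV :: real set) \<lesssim> S"
    by (meson lepoll_trans subset_imp_lepoll)
qed

lemma euclidean_discrete: "(euclidean :: 'a::discrete_topology topology) = discrete_topology UNIV"
  by (simp add: topology_eq open_discrete)

lemma completely_metrizable_fun_discrete:
  "completely_metrizable_space (euclidean :: ('a::countable \<Rightarrow> 'b::discrete_topology) topology)"
proof -
  have "completely_metrizable_space
    (product_topology (\<lambda>_::'a. discrete_topology (UNIV :: 'b set)) UNIV)"
    by (simp add: completely_metrizable_space_product_topology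
        completely_metrizable_space_discrete_topology)
  then show ?thesis
    by (simp add: euclidean_discrete[symmetric] euclidean_product_topology)
qed

section \<open>Generated logics\<close>

instance fm :: countable
  by countable_datatype

definition generated_logic :: "fm set \<Rightarrow> fm set" where
  "generated_logic A = \<Inter>{M. tense_logic M \<and> A \<subseteq> M}"

definition tense_axioms :: "fm set" where
  "tense_axioms = {\<phi>. tautology \<phi>} \<union>
     (\<Union>p q. {Imp (Box0 (Imp (Var p) (Var q))) (Imp (Box0 (Var p)) (Box0 (Var q))),
             Imp (Box1 (Imp (Var p) (Var q))) (Imp (Box1 (Var p)) (Box1 (Var q))),
             Imp (Var p) (Box0 (Neg (Box1 (Neg (Var p))))),
             Imp (Var p) (Box1 (Neg (Box0 (Neg (Var p)))))})"

definition unary_rules :: "(fm \<Rightarrow> fm) set" where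
  "unary_rules = {Box0, Box1} \<union> range subst"

text \<open>This form of the definition sorts the closure conditions by their number of premises, which
  is all that matters for intersections and directed unions of logics.\<close>

lemma tense_logic_iff:
  "tense_logic M \<longleftrightarrow> tense_axioms \<subseteq> M \<and>
     (\<forall>\<phi> \<psi>. Imp \<phi> \<psi> \<in> M \<longrightarrow> \<phi> \<in> M \<longrightarrow> \<psi> \<in> M) \<and> (\<forall>f\<in>unary_rules. \<forall>\<phi>\<in>M. f \<phi> \<in> M)"
proof -
  have axioms: "tense_axioms \<subseteq> M \<longleftrightarrow>
     (\<forall>\<phi>. tautology \<phi> \<longrightarrow> \<phi> \<in> M) \<and>
     (\<forall>p q. Imp (Box0 (Imp (Var p) (Var q))) (Imp (Box0 (Var p)) (Box0 (Var q))) \<in> M) \<and>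
     (\<forall>p q. Imp (Box1 (Imp (Var p) (Var q))) (Imp (Box1 (Var p)) (Box1 (Var q))) \<in> M) \<and>
     (\<forall>p. Imp (Var p) (Box0 (Neg (Box1 (Neg (Var p))))) \<in> M) \<and>
     (\<forall>p. Imp (Var p) (Box1 (Neg (Box0 (Neg (Var p))))) \<in> M)"
    unfolding tense_axioms_def by auto
  have unary: "(\<forall>f\<in>unary_rules. \<forall>\<phi>\<in>M. f \<phi> \<in> M) \<longleftrightarrow>
     (\<forall>\<phi>. \<phi> \<in> M \<longrightarrow> Box0 \<phi> \<in> M) \<and> (\<forall>\<phi>. \<phi> \<in> M \<longrightarrow> Box1 \<phi> \<in> M) \<and>
     (\<forall>s \<phi>. \<phi> \<in> M \<longrightarrow> subst s \<phi> \<in> M)"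
    by (auto simp: unary_rules_def)
  show ?thesis
    unfolding tense_logic_def axioms unary
    by (rule iffI; elim conjE; intro conjI; assumption)
qed

lemma tense_logic_generated: "tense_logic (generated_logic A)"
proof -
  have "\<psi> \<in> generated_logic A"
    if "Imp \<phi> \<psi> \<in> generated_logic A" "\<phi> \<in> generated_logic A" for \<phi> \<psi>
    unfolding generated_logic_def
  proof (rule InterI)
    fix M assume M: "M \<in> {M. tense_logic M \<and> A \<subseteq> M}"
    then have "Imp \<phi> \<psi> \<in> M" "\<phi> \<in> M"
      using that by (auto simp: generated_logic_def)
    then show "\<psi> \<in> M"
      using M unfolding tense_logic_iff by blast
  qed
  moreover have "tense_axioms \<subseteq> generated_logic A"
    by (auto simp: generated_logic_def tense_logic_iff)
  moreover have "\<forall>f\<in>unary_rules. \<forall>\<phi>\<in>generated_logic A. f \<phi> \<in> generated_logic A"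
    by (simp add: generated_logic_def tense_logic_iff)
  ultimately show ?thesis
    unfolding tense_logic_iff by blast
qed

lemma generated_logic_superset: "A \<subseteq> generated_logic A"
  unfolding generated_logic_def by blast

lemma generated_logic_least: "tense_logic M \<Longrightarrow> A \<subseteq> M \<Longrightarrow> generated_logic A \<subseteq> M"
  unfolding generated_logic_def by blast

lemma generated_logic_mono: "A \<subseteq> B \<Longrightarrow> generated_logic A \<subseteq> generated_logic B"
  unfolding generated_logic_def by blast

text \<open>The directed union of the logics generated by the finite subsets of \<open>A\<close> is a logic, since
  each closure rule has only finitely many premises.\<close>

lemma generated_logic_finitary:
  assumes "\<psi> \<in> generated_logic A"
  obtains B where "finite B" "B \<subseteq> A" "\<psi> \<in> generated_logic B"
proof -
  define M where "M = \<Union>(generated_logic ` {B. finite B \<and> B \<subseteq> A})"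
  have in_M: "\<phi> \<in> M \<longleftrightarrow> (\<exists>B. finite B \<and> B \<subseteq> A \<and> \<phi> \<in> generated_logic B)" for \<phi>
    by (auto simp: M_def)
  have "\<phi>' \<in> M" if imp: "Imp \<phi> \<phi>' \<in> M" and ant: "\<phi> \<in> M" for \<phi> \<phi>'
  proof -
    obtain B1 where B1: "finite B1" "B1 \<subseteq> A" "Imp \<phi> \<phi>' \<in> generated_logic B1"
      using imp in_M by blast
    obtain B2 where B2: "finite B2" "B2 \<subseteq> A" "\<phi> \<in> generated_logic B2"
      using ant in_M by blast
    have "Imp \<phi> \<phi>' \<in> generated_logic (B1 \<union> B2)"
      using B1(3) generated_logic_mono[of B1 "B1 \<union> B2"] by blast
    moreover have "\<phi> \<in> generated_logic (B1 \<union> B2)"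
      using B2(3) generated_logic_mono[of B2 "B1 \<union> B2"] by blast
    ultimately have "\<phi>' \<in> generated_logic (B1 \<union> B2)"
      using tense_logic_generated[of "B1 \<union> B2"] unfolding tense_logic_iff by blast
    then show ?thesis
      using B1 B2 in_M by (metis finite_UnI le_sup_iff)
  qed
  moreover have "tense_axioms \<subseteq> M"
  proof -
    have "tense_axioms \<subseteq> generated_logic {}"
      using tense_logic_generated[of "{}"] unfolding tense_logic_iff by simp
    also have "\<dots> \<subseteq> M"
      unfolding M_def by (rule Union_upper) simp
    finally show ?thesis .
  qed
  moreover have "f \<phi> \<in> M" if f: "f \<in> unary_rules" and "\<phi> \<in> M" for f \<phi>
  proof -
    obtain B where B: "finite B" "B \<subseteq> A" "\<phi> \<in> generated_logic B"
      using \<open>\<phi> \<in> M\<close> in_M by blast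
    moreover have "f \<phi> \<in> generated_logic B"
      using tense_logic_generated[of B] f B(3) by (simp add: tense_logic_iff)
    ultimately show ?thesis
      using in_M by blast
  qed
  ultimately have "tense_logic M"
    unfolding tense_logic_iff by blast
  moreover have "A \<subseteq> M"
  proof
    fix \<phi> assume "\<phi> \<in> A"
    then have "finite {\<phi>}" "{\<phi>} \<subseteq> A" "\<phi> \<in> generated_logic {\<phi>}"
      using generated_logic_superset by auto
    then show "\<phi> \<in> M"
      unfolding in_M by blast
  qed
  ultimately have "\<psi> \<in> M"
    using assms generated_logic_least by blast
  then show ?thesis
    using that in_M by blast
qed

section \<open>Tabular and pretabular logics\<close>

lemma countable_tabular: "countable {L. tabular L}"
proof -
  define frames where "frames = {F :: nat set. finite F} \<times> {R :: nat rel. finite R}"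
  have "{L. tabular L} \<subseteq> (\<lambda>(F, R). {\<phi>. frame_valid F R \<phi>}) ` frames"
  proof
    fix L assume "L \<in> {L. tabular L}"
    then obtain F :: "nat set" and R where FR: "kripke_frame F R" "finite F"
      "L = {\<phi>. frame_valid F R \<phi>}"
      unfolding tabular_def by blast
    then have "finite R"
      unfolding kripke_frame_def by (meson finite_SigmaI finite_subset)
    with FR show "L \<in> (\<lambda>(F, R). {\<phi>. frame_valid F R \<phi>}) ` frames"
      unfolding frames_def by force
  qed
  moreover have "countable frames"
    unfolding frames_def by (intro countable_SIGMA countable_Collect_finite)
  ultimately show ?thesis
    by (meson countable_image countable_subset)
qed

text \<open>Pretabularity of \<open>L\<close> concerns all proper extensions of \<open>L\<close>. Quantifying over the extensions of
  \<open>M\<close> here makes it enough to test the extensions that are generated by \<open>L\<close> and one new formula.\<close>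

definition hereditarily_tabular :: "fm set set" where
  "hereditarily_tabular =
     {M. tense_logic M \<and> (\<forall>M'. extension M M' \<and> consistent M' \<longrightarrow> tabular M')}"

lemma countable_hereditarily_tabular: "countable hereditarily_tabular"
proof (rule countable_subset)
  show "hereditarily_tabular \<subseteq> insert UNIV {L. tabular L}"
    by (auto simp: hereditarily_tabular_def extension_def consistent_def)
  show "countable (insert UNIV {L. tabular L})"
    using countable_tabular by simp
qed

lemma pretabular_iff:
  "pretabular L \<longleftrightarrow> tense_logic L \<and> \<not> tabular L \<and>
     (\<forall>\<phi>. \<phi> \<notin> L \<longrightarrow> generated_logic (insert \<phi> L) \<in> hereditarily_tabular)"
  (is "_ \<longleftrightarrow> ?r")
proof
  assume L: "pretabular L"
  have "generated_logic (insert \<phi> L) \<in> hereditarily_tabular" if "\<phi> \<notin> L" for \<phi>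
    using L that generated_logic_superset[of "insert \<phi> L"] tense_logic_generated
    unfolding hereditarily_tabular_def pretabular_def extension_def by blast
  then show ?r
    using L by (auto simp: pretabular_def)
next
  assume r: ?r
  have "tabular L'" if L': "extension L L'" "L' \<noteq> L" "consistent L'" for L'
  proof -
    obtain \<phi> where \<phi>: "\<phi> \<in> L'" "\<phi> \<notin> L"
      using L' by (auto simp: extension_def)
    then have "extension (generated_logic (insert \<phi> L)) L'"
      using L' generated_logic_least by (simp add: extension_def)
    then show ?thesis
      using r \<phi> L' by (auto simp: hereditarily_tabular_def)
  qed
  then show "pretabular L"
    using r by (auto simp: pretabular_def)
qed

section \<open>Coding pretabular logics in Baire space\<close>

definition zeros :: "(fm \<Rightarrow> nat) \<Rightarrow> fm set" where
  "zeros x = {\<phi>. x \<phi> = 0}"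

text \<open>The successor reserves \<open>0\<close> for the members of the coded logic.\<close>

definition index :: "fm set \<Rightarrow> nat" where
  "index M = Suc (to_nat_on hereditarily_tabular M)"

lemma inj_on_index: "inj_on index hereditarily_tabular"
  using inj_on_to_nat_on[OF countable_hereditarily_tabular] by (auto simp: index_def inj_on_def)

definition pretabular_code :: "fm set \<Rightarrow> fm \<Rightarrow> nat" where
  "pretabular_code L \<phi> = (if \<phi> \<in> L then 0 else index (generated_logic (insert \<phi> L)))"

lemma zeros_pretabular_code [simp]: "zeros (pretabular_code L) = L"
  by (auto simp: zeros_def pretabular_code_def index_def)

text \<open>Each clause quantifies universally over countable sets, and its matrix is clopen, open or
  closed in \<open>x\<close>; the existential quantifier over indices has become a condition on the value
  \<open>x \<phi>\<close> alone.\<close>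

lemma pretabular_codes_eq:
  "pretabular_code ` {L'. extension L L' \<and> pretabular L'} =
     {x. tense_logic (zeros x)} \<inter> {x. L \<subseteq> zeros x} \<inter> {x. \<not> tabular (zeros x)} \<inter>
     (\<Inter>\<phi>. {x. x \<phi> \<in> insert 0 (index ` hereditarily_tabular)}) \<inter>
     (\<Inter>\<phi>. \<Inter>M\<in>hereditarily_tabular. \<Inter>\<psi>.
        {x. x \<phi> = index M \<longrightarrow> (\<psi> \<in> generated_logic (insert \<phi> (zeros x)) \<longleftrightarrow> \<psi> \<in> M)})"
  (is "?codes = ?S")
proof
  show "?codes \<subseteq> ?S"
  proof
    fix x assume "x \<in> ?codes"
    then obtain L' where L': "extension L L'" "pretabular L'" and x: "x = pretabular_code L'"
      by blast
    have gen: "generated_logic (insert \<phi> L') \<in> hereditarily_tabular" if "\<phi> \<notin> L'" for \<phi>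
      using L'(2) that by (simp add: pretabular_iff)
    have "x \<phi> \<in> insert 0 (index ` hereditarily_tabular)" for \<phi>
      using gen by (simp add: x pretabular_code_def)
    moreover have "generated_logic (insert \<phi> (zeros x)) = M"
      if "M \<in> hereditarily_tabular" "x \<phi> = index M" for \<phi> M
    proof -
      have "\<phi> \<notin> L'" "index (generated_logic (insert \<phi> L')) = index M"
        using that(2) by (auto simp: x pretabular_code_def index_def split: if_splits)
      then show ?thesis
        using inj_onD[OF inj_on_index] gen that(1) by (simp add: x)
    qed
    ultimately show "x \<in> ?S"
      using L' by (auto simp: x extension_def pretabular_iff)
  qed
next
  show "?S \<subseteq> ?codes"
  proof
    fix x assume x: "x \<in> ?S"
    have eq: "generated_logic (insert \<phi> (zeros x)) = M"
      if "M \<in> hereditarily_tabular" "x \<phi> = index M" for \<phi> M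
      using x that by blast
    have val: "\<exists>M \<in> hereditarily_tabular. x \<phi> = index M" if "\<phi> \<notin> zeros x" for \<phi>
    proof -
      have "x \<phi> \<in> insert 0 (index ` hereditarily_tabular)"
        using x by blast
      then show ?thesis
        using that by (auto simp: zeros_def)
    qed
    have "generated_logic (insert \<phi> (zeros x)) \<in> hereditarily_tabular" if "\<phi> \<notin> zeros x" for \<phi>
      using eq val[OF that] by auto
    then have "pretabular (zeros x)"
      unfolding pretabular_iff using x by blast
    moreover have "extension L (zeros x)"
      using x by (simp add: extension_def)
    moreover have "x = pretabular_code (zeros x)"
    proof
      fix \<phi>
      show "x \<phi> = pretabular_code (zeros x) \<phi>"
        using eq val[of \<phi>] by (auto simp: pretabular_code_def zeros_def)
    qed
    ultimately show "x \<in> ?codes"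
      by blast
  qed
qed

section \<open>Complexity of the set of codes\<close>

lemma closed_imp_gdelta_in_fun_discrete:
  fixes S :: "('a::countable \<Rightarrow> 'b::discrete_topology) set"
  shows "closed S \<Longrightarrow> gdelta_in euclidean S"
  using closed_imp_gdelta_in completely_metrizable_fun_discrete
    completely_metrizable_imp_metrizable_space by fastforce

lemma gdelta_in_INT:
  assumes "countable I" "\<And>i. i \<in> I \<Longrightarrow> gdelta_in euclidean (S i)"
  shows "gdelta_in euclidean (\<Inter>i\<in>I. S i)"
proof (cases "I = {}")
  case True
  then show ?thesis
    using gdelta_in_topspace[of euclidean] by simp
next
  case False
  then show ?thesis
    using assms by (intro gdelta_in_Inter) auto
qed

lemma open_Collect_coordinate:
  fixes P :: "'b::discrete_topology \<Rightarrow> bool"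
  shows "open {x :: 'a \<Rightarrow> 'b. P (x i)}"
proof -
  have "open ((\<lambda>x :: 'a \<Rightarrow> 'b. x i) -` {b. P b})"
    by (intro open_vimage open_discrete continuous_on_product_coordinates)
  then show ?thesis
    by (simp add: vimage_def)
qed

lemma closed_Collect_coordinate:
  fixes P :: "'b::discrete_topology \<Rightarrow> bool"
  shows "closed {x :: 'a \<Rightarrow> 'b. P (x i)}"
  using open_Collect_coordinate[of "\<lambda>b. \<not> P b" i] by (simp add: closed_def Collect_neg_eq)

lemma closed_Collect_zeros: "closed {x. \<phi> \<in> zeros x}"
  unfolding zeros_def mem_Collect_eq by (rule closed_Collect_coordinate)

lemma open_Collect_zeros: "open {x. \<phi> \<in> zeros x}"
  unfolding zeros_def mem_Collect_eq by (rule open_Collect_coordinate)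

lemma closed_Collect_tense_logic: "closed {x. tense_logic (zeros x)}"
  unfolding tense_logic_def
  by (intro closed_Collect_conj closed_Collect_all closed_Collect_imp closed_Collect_const
      closed_Collect_zeros open_Collect_zeros open_Collect_const)

lemma closed_Collect_superset: "closed {x. L \<subseteq> zeros x}"
  unfolding subset_eq Ball_def
  by (intro closed_Collect_all closed_Collect_imp closed_Collect_zeros open_Collect_const)

lemma gdelta_in_Collect_not_tabular: "gdelta_in euclidean {x. \<not> tabular (zeros x)}"
proof -
  have "open {x. zeros x \<noteq> M}" for M
  proof -
    have "{x. zeros x \<noteq> M} = {x. \<exists>\<phi>. (x \<phi> = 0) \<noteq> (\<phi> \<in> M)}"
      by (auto simp: zeros_def)
    then show ?thesis
      by (simp only:) (intro open_Collect_ex open_Collect_coordinate)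
  qed
  then have "gdelta_in euclidean (\<Inter>M \<in> {M. tabular M}. {x. zeros x \<noteq> M})"
    by (intro gdelta_in_INT countable_tabular open_imp_gdelta_in) simp
  moreover have "(\<Inter>M \<in> {M. tabular M}. {x. zeros x \<noteq> M}) = {x. \<not> tabular (zeros x)}"
    by auto
  ultimately show ?thesis
    by simp
qed

text \<open>A derivation of \<open>\<psi>\<close> uses only finitely many of the premises in \<open>zeros x\<close>, and finitely many
  coordinates of \<open>x\<close> determine that these are there.\<close>

lemma open_Collect_generated: "open {x. \<psi> \<in> generated_logic (insert \<phi> (zeros x))}"
proof -
  have "\<psi> \<in> generated_logic (insert \<phi> (zeros x)) \<longleftrightarrow>
    (\<exists>B. (finite B \<and> \<psi> \<in> generated_logic (insert \<phi> B)) \<and> B \<subseteq> zeros x)" for x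
  proof
    assume "\<psi> \<in> generated_logic (insert \<phi> (zeros x))"
    then obtain B where "finite B" "B \<subseteq> insert \<phi> (zeros x)" "\<psi> \<in> generated_logic B"
      by (rule generated_logic_finitary)
    moreover have "B \<subseteq> insert \<phi> (B - {\<phi>})"
      by blast
    ultimately have "finite (B - {\<phi>}) \<and> \<psi> \<in> generated_logic (insert \<phi> (B - {\<phi>}))"
      "B - {\<phi>} \<subseteq> zeros x"
      using generated_logic_mono by blast+
    then show "\<exists>B. (finite B \<and> \<psi> \<in> generated_logic (insert \<phi> B)) \<and> B \<subseteq> zeros x"
      by blast
  next
    assume "\<exists>B. (finite B \<and> \<psi> \<in> generated_logic (insert \<phi> B)) \<and> B \<subseteq> zeros x"
    then show "\<psi> \<in> generated_logic (insert \<phi> (zeros x))"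
      using generated_logic_mono[OF insert_mono] by (meson subsetD)
  qed
  moreover have "open {x. (finite B \<and> \<psi> \<in> generated_logic (insert \<phi> B)) \<and> B \<subseteq> zeros x}" for B
  proof (cases "finite B")
    case True
    have "{x. B \<subseteq> zeros x} = (\<Inter>\<theta>\<in>B. {x. \<theta> \<in> zeros x})"
      by blast
    then have "open {x. B \<subseteq> zeros x}"
      using True open_Collect_zeros by (simp add: open_INT)
    then show ?thesis
      by (intro open_Collect_conj open_Collect_const)
  qed simp
  ultimately show ?thesis
    by (simp add: open_Collect_ex)
qed

lemma gdelta_in_pretabular_codes:
  "gdelta_in euclidean (pretabular_code ` {L'. extension L L' \<and> pretabular L'})"
proof -
  have "gdelta_in euclidean
    {x. x \<phi> = index M \<longrightarrow> (\<psi> \<in> generated_logic (insert \<phi> (zeros x)) \<longleftrightarrow> \<psi> \<in> M)}" for \<phi> \<psi> M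
  proof (cases "\<psi> \<in> M")
    case True
    have "open {x. x \<phi> = index M \<longrightarrow> \<psi> \<in> generated_logic (insert \<phi> (zeros x))}"
      by (intro open_Collect_imp closed_Collect_coordinate open_Collect_generated)
    with True show ?thesis
      by (intro open_imp_gdelta_in) simp
  next
    case False
    have "closed {x. x \<phi> = index M \<longrightarrow> \<psi> \<notin> generated_logic (insert \<phi> (zeros x))}"
      by (intro closed_Collect_imp open_Collect_coordinate closed_Collect_neg
          open_Collect_generated)
    with False show ?thesis
      by (intro closed_imp_gdelta_in_fun_discrete) simp
  qed
  moreover have "gdelta_in euclidean
      {x :: fm \<Rightarrow> nat. x \<phi> \<in> insert 0 (index ` hereditarily_tabular)}" for \<phi>
    by (intro closed_imp_gdelta_in_fun_discrete closed_Collect_coordinate)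
  ultimately show ?thesis
    unfolding pretabular_codes_eq
    by (intro gdelta_in_Int gdelta_in_INT gdelta_in_Collect_not_tabular
        closed_imp_gdelta_in_fun_discrete[OF closed_Collect_tense_logic]
        closed_imp_gdelta_in_fun_discrete[OF closed_Collect_superset]
        countableI_type countable_hereditarily_tabular)
qed

section \<open>The number of pretabular extensions\<close>

theorem theorem3p14:
  fixes L :: "fm set"
  assumes "tense_logic L"
  shows "countable {L'. extension L L' \<and> pretabular L'} \<or>
         {L'. extension L L' \<and> pretabular L'} \<approx> (UNIV :: nat set set)"
proof -
  let ?P = "{L'. extension L L' \<and> pretabular L'}"
  have "inj_on pretabular_code ?P"
    by (rule inj_on_inverseI) (rule zeros_pretabular_code)
  then have codes: "?P \<approx> pretabular_code ` ?P"
    using inj_on_image_eqpoll_self eqpoll_sym by blast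
  consider "countable (pretabular_code ` ?P)" | "(UNIV :: real set) \<lesssim> pretabular_code ` ?P"
    using gdelta_in_perfect_set_property[OF completely_metrizable_fun_discrete
        gdelta_in_pretabular_codes[of L]] by blast
  then show ?thesis
  proof cases
    case 1
    then show ?thesis
      using codes countable_eqpoll by blast
  next
    case 2
    have "(UNIV :: nat set set) \<lesssim> ?P"
      using nat_sets_eqpoll_reals 2 codes
      by (meson eqpoll_imp_lepoll eqpoll_sym lepoll_trans)
    moreover have "?P \<lesssim> (UNIV :: nat set set)"
    proof -
      have "inj (image (to_nat :: fm \<Rightarrow> nat))"
        by (simp add: inj_def inj_image_eq_iff)
      then have "(UNIV :: fm set set) \<lesssim> (UNIV :: nat set set)"
        by (auto simp: lepoll_def)
      then show ?thesis
        by (meson lepoll_trans subset_UNIV subset_imp_lepoll)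
    qed
    ultimately show ?thesis
      by (simp add: lepoll_antisym)
  qed
qed

end
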